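(* Let $H$ be a real Hilbert space and $\mathcal{E}$ an orthonormal basis of $H$. Let $\mathcal{E}'\subset\mathcal{E}$ be a finite set, and let $Y=\{y_j\}_j$ be a set of unit-norm elements belonging to $\operatorname{span}\{\mathcal{E}'\}$. Consider the dictionary $\mathcal{D}=\mathcal{E}^{\pm}\cup Y^{\pm}$. Assume that every element of $H$ has at least one greedy expansion with respect to $\mathcal{D}$ with weakening parameter $t=1$, for every sequence of positive prescribed coefficients. Let $C=\{c_p\}_{p=1}^\infty$ be a sequence of positive real prescribed coefficients such that $\lim_{p\to\infty}c_p=0$ and $\sum_{p=1}^{\infty}c_p=\infty$. Then for every $f\in H$, all the possible greedy expansions of $f$ with respect to the dictionary $\mathcal{D}$ with prescribed coefficients $C$ and weakening parameter $t=1$ converge to $f$.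
   Context: Let $H$ be a real Hilbert space with inner product $\langle\cdot,\cdot\rangle$. A dictionary $\mathcal{D}\subset H$ is a set of unit-norm vectors whose linear span is dense in $H$. For a set $A\subset H$, its symmetrized set is $A^{\pm}:=\bigcup_{g\in A}\{g,-g\}$. Greedy expansion with prescribed coefficients $C=\{c_n\}_{n=1}^\infty$, $c_n>0$, and weakening parameter $t=1$. For $f\in H$ put $f_0:=f$, $G_0:=0$. For $m\ge 1$, if $f_{m-1}\neq 0$, choose an element $\varphi_m\in\mathcal{D}$ such that $\langle f_{m-1},\varphi_m\rangle= \sup_{g\in\mathcal{D}}\langle f_{m-1},g\rangle$, and set $f_m:=f_{m-1}-c_m\varphi_m$, $G_m:=G_{m-1}+c_m\varphi_m$. The series $\sum_n c_n\varphi_n$ is called a greedy expansion of $f$. If $f_{m-1}=0$ the algorithm stops; the expansion is then the finite sum $G_{m-1}=f$ and is regarded as converging to $f$. The choice of $\varphi_m$ need not be unique (and, if the supremum is not attained, may be impossible), so $f$ may have several greedy expansions; the claim concerns every sequence of admissible choices. A greedy expansion converges to $f$ if $\lim_{m\to\infty}G_m=f$ in norm, i.e. $\lim_{m\to\infty}\|f_m\|=0$. *)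

theory Defs
  imports "HOL-Analysis.Analysis"
begin

text \<open>A real Hilbert space is a type of sort \<open>{real_inner, complete_space}\<close>; it may be
  finite- or infinite-dimensional, and is not assumed separable.\<close>

definition orthonormal_basis :: "'a::real_inner set \<Rightarrow> bool" where
  "orthonormal_basis E \<longleftrightarrow>
     pairwise orthogonal E \<and> (\<forall>e\<in>E. norm e = 1) \<and> closure (span E) = UNIV"

definition dictionary :: "'a::real_inner set \<Rightarrow> bool" where
  "dictionary D \<longleftrightarrow> (\<forall>g\<in>D. norm g = 1) \<and> closure (span D) = UNIV"

definition symmetrized :: "'a::real_inner set \<Rightarrow> 'a set" where
  "symmetrized A = (\<Union>g\<in>A. {g, - g})"

text \<open>Indices of coefficients and chosen elements start at 0: \<open>c m\<close> and \<open>\<phi> m\<close> stand for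
  $c_{m+1}$ and $\varphi_{m+1}$, whereas \<open>r m\<close> and \<open>G m\<close> are the remainder $f_m$ and the partial
  sum $G_m$. Once the remainder vanishes the algorithm stops; this is encoded by keeping \<open>r\<close> and
  \<open>G\<close> constant from then on, and the later values of \<open>\<phi>\<close> are irrelevant. The real-valued
  supremum is the true one whenever the elements of \<open>D\<close> have unit norm (the inner products are
  then bounded by \<open>norm (r m)\<close>, and \<open>\<phi> m \<in> D\<close> excludes the empty set).\<close>

definition greedy_expansion ::
  "'a::real_inner set \<Rightarrow> (nat \<Rightarrow> real) \<Rightarrow> 'a \<Rightarrow> (nat \<Rightarrow> 'a) \<Rightarrow> (nat \<Rightarrow> 'a) \<Rightarrow> (nat \<Rightarrow> 'a) \<Rightarrow> bool"
where
  "greedy_expansion D c f \<phi> r G \<longleftrightarrow>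
     r 0 = f \<and> G 0 = 0 \<and>
     (\<forall>m. if r m \<noteq> 0
          then \<phi> m \<in> D \<and> inner (r m) (\<phi> m) = (SUP g\<in>D. inner (r m) g) \<and>
               r (Suc m) = r m - c m *\<^sub>R \<phi> m \<and> G (Suc m) = G m + c m *\<^sub>R \<phi> m
          else r (Suc m) = r m \<and> G (Suc m) = G m)"

lemma dictionary_symmetrized_Un:
  assumes "orthonormal_basis E" and "\<forall>y\<in>Y. norm y = 1"
  shows "dictionary (symmetrized E \<union> symmetrized Y)"
proof -
  let ?D = "symmetrized E \<union> symmetrized Y"
  have "E \<subseteq> ?D" by (auto simp: symmetrized_def)
  then have "closure (span E) \<subseteq> closure (span ?D)" by (intro closure_mono span_mono)
  then have "closure (span ?D) = UNIV" using assms(1) by (auto simp: orthonormal_basis_def)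
  moreover have "\<forall>g\<in>?D. norm g = 1"
    using assms by (auto simp: symmetrized_def orthonormal_basis_def)
  ultimately show ?thesis by (simp add: dictionary_def)
qed

lemma greedy_expansion_partial_sum:
  assumes "greedy_expansion D c f \<phi> r G"
  shows "G m + r m = f"
proof (induction m)
  case 0
  then show ?case using assms by (simp add: greedy_expansion_def)
next
  case (Suc m)
  have "G (Suc m) + r (Suc m) = G m + r m"
    using assms unfolding greedy_expansion_def by (cases "r m = 0") auto
  with Suc show ?case by simp
qed

end

theory Submission
  imports Defs
begin

text \<open>Write \<open>\<sigma>\<^sub>m = \<langle>f\<^sub>m, \<phi>\<^sub>m\<rangle>\<close> and split \<open>f\<^sub>m\<close> into its component \<open>u\<^sub>m\<close> in
  \<open>span E'\<close> and its coordinates along \<open>E - E'\<close>; each step changes either \<open>u\<^sub>m\<close> or a single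
  coordinate. As \<open>\<Sum> c = \<infinity>\<close> and \<open>\<parallel>f\<^sub>m\<parallel>\<^sup>2\<close> changes by \<open>- 2 c \<sigma> + c\<^sup>2\<close>, the \<open>\<sigma>\<^sub>m\<close> come
  arbitrarily close to 0. Since \<open>\<parallel>u\<^sub>m\<parallel>\<close> is at most a constant times \<open>\<sigma>\<^sub>m\<close>, once \<open>\<sigma>\<^sub>m\<close> and all
  later coefficients are small, \<open>\<sigma>\<close> stays small, so \<open>\<sigma>\<^sub>m \<rightarrow> 0\<close>. If a step pushes a coordinate
  along \<open>e \<in> E - E'\<close> above its initial modulus, then this coordinate dominates all other inner
  products, and the algorithm keeps choosing \<open>\<plusminus>e\<close> until the coordinate has returned below its
  initial modulus. Hence at any time all coordinates along \<open>E - E'\<close> but one are dominated by those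
  of \<open>f\<close>, and the exceptional one is at most \<open>\<sigma>\<^sub>m\<close>; dominated convergence finishes the proof.\<close>

section \<open>Orthogonal projection onto the span of a finite orthonormal set\<close>

definition orthonormal_proj :: "'a::real_inner set \<Rightarrow> 'a \<Rightarrow> 'a" where
  "orthonormal_proj S x = (\<Sum>e\<in>S. inner x e *\<^sub>R e)"

locale orthonormal_set =
  fixes E :: "'a::real_inner set"
  assumes orth: "pairwise orthogonal E" and unit: "e \<in> E \<Longrightarrow> norm e = 1"
begin

lemma inner_basis:
  "e \<in> E \<Longrightarrow> e' \<in> E \<Longrightarrow> inner e e' = (if e = e' then 1 else 0)"
  using orth unit by (auto simp: pairwise_def orthogonal_def norm_eq_1)

lemma inner_span_eq_0:
  assumes "e \<in> E" "S \<subseteq> E" "e \<notin> S" "x \<in> span S"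
  shows "inner x e = 0"
  using \<open>x \<in> span S\<close>
proof (induction rule: span_induct_alt)
  case (step k a y)
  then have "inner a e = 0" using assms inner_basis[of a e] by auto
  then show ?case using step by (simp add: inner_add_left)
qed simp

context
  fixes S assumes S: "S \<subseteq> E" "finite S"
begin

lemma inner_orthonormal_proj:
  assumes "e \<in> S" shows "inner (orthonormal_proj S x) e = inner x e"
proof -
  have "inner (orthonormal_proj S x) e = (\<Sum>d\<in>S. inner x d * (if d = e then 1 else 0))"
    unfolding orthonormal_proj_def inner_sum_left
    using S assms by (intro sum.cong) (auto simp: inner_basis subset_eq)
  also have "\<dots> = inner x e" using S assms by (simp add: if_distrib cong: if_cong)
  finally show ?thesis .
qed

lemma orthonormal_proj_in_span: "orthonormal_proj S x \<in> span S"
  unfolding orthonormal_proj_def by (intro span_sum span_scale span_base)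

lemma inner_orthonormal_proj_span:
  assumes "y \<in> span S" shows "inner (orthonormal_proj S x) y = inner x y"
  using assms
proof (induction rule: span_induct_alt)
  case (step k a y)
  then show ?case by (simp add: inner_add_right inner_orthonormal_proj)
qed simp

lemma norm_orthonormal_proj: "(norm (orthonormal_proj S x))\<^sup>2 = (\<Sum>e\<in>S. (inner x e)\<^sup>2)"
proof -
  have "(norm (orthonormal_proj S x))\<^sup>2 = inner x (orthonormal_proj S x)"
    by (simp add: power2_norm_eq_inner inner_orthonormal_proj_span orthonormal_proj_in_span)
  also have "\<dots> = (\<Sum>e\<in>S. (inner x e)\<^sup>2)"
    by (simp add: orthonormal_proj_def inner_sum_right power2_eq_square)
  finally show ?thesis .
qed

text \<open>The residual of the projection is orthogonal to \<open>span S\<close>, so this is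
  Pythagoras' theorem.\<close>

lemma norm_diff_span:
  assumes "y \<in> span S"
  shows "(norm (x - y))\<^sup>2 = (norm (x - orthonormal_proj S x))\<^sup>2 + (norm (orthonormal_proj S x - y))\<^sup>2"
proof -
  let ?p = "orthonormal_proj S x"
  have "?p - y \<in> span S" using assms by (intro span_diff orthonormal_proj_in_span)
  then have "inner (x - ?p) (?p - y) = 0"
    by (simp add: inner_diff_left inner_orthonormal_proj_span)
  then show ?thesis
    using norm_add_Pythagorean[of "x - ?p" "?p - y"] by (simp add: orthogonal_def)
qed

lemma norm_diff_orthonormal_proj_le:
  assumes "y \<in> span S" shows "norm (x - orthonormal_proj S x) \<le> norm (x - y)"
  using norm_diff_span[OF assms, of x] zero_le_power2[of "norm (orthonormal_proj S x - y)"]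
  by (metis le_add_same_cancel1 norm_ge_zero power2_le_imp_le)

lemma norm_sq_orthonormal_proj:
  "(norm x)\<^sup>2 = (norm (x - orthonormal_proj S x))\<^sup>2 + (\<Sum>e\<in>S. (inner x e)\<^sup>2)"
  using norm_diff_span[of 0 x] by (simp add: span_zero norm_orthonormal_proj)

text \<open>The best approximation of \<open>y\<close> from a span that contains \<open>y\<close> is
  at distance 0.\<close>

lemma orthonormal_proj_span: "y \<in> span S \<Longrightarrow> orthonormal_proj S y = y"
  using norm_diff_orthonormal_proj_le[of y y] by simp

lemma orthonormal_proj_diff:
  "orthonormal_proj S (x - y) = orthonormal_proj S x - orthonormal_proj S y"
  by (simp add: orthonormal_proj_def inner_diff_left scaleR_diff_left sum_subtractf)

end

text \<open>This replaces the orthonormal series of \<open>x\<close> and keeps all later sums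
  finite, whatever the cardinality of \<open>E\<close>.\<close>

lemma finite_span_approx:
  assumes "closure (span E) = UNIV" "0 < \<epsilon>"
  obtains S y where "S \<subseteq> E" "finite S" "y \<in> span S" "norm (x - y) < \<epsilon>"
proof -
  have "x \<in> closure (span E)" using assms by simp
  then obtain y where "y \<in> span E" "dist y x < \<epsilon>"
    using \<open>0 < \<epsilon>\<close> unfolding closure_approachable by blast
  moreover obtain S where "finite S" "S \<subseteq> E" "y \<in> span S"
  proof -
    obtain S a where S: "finite S" "S \<subseteq> E" and y: "y = (\<Sum>e\<in>S. a e *\<^sub>R e)"
      using \<open>y \<in> span E\<close> unfolding span_explicit by blast
    have "y \<in> span S" unfolding y by (intro span_sum span_scale span_base)
    then show thesis using that S by blast
  qed
  ultimately show thesis using that by (simp add: dist_norm norm_minus_commute)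
qed

end

section \<open>Greedy algorithm whose remainder never vanishes\<close>

text \<open>Signed elements of \<open>E'\<close> and of \<open>Y\<close> are treated alike, as unit
  vectors of \<open>span E'\<close>; this is what \<open>D_cases\<close> records.\<close>

locale nonvanishing_greedy = orthonormal_set E
  for E :: "'a::real_inner set" +
  fixes E' D :: "'a set" and c :: "nat \<Rightarrow> real" and \<phi> r :: "nat \<Rightarrow> 'a"
  assumes dense: "closure (span E) = UNIV"
    and E': "E' \<subseteq> E" "finite E'"
    and D_unit: "g \<in> D \<Longrightarrow> norm g = 1"
    and D_cases: "g \<in> D \<Longrightarrow> g \<in> span E' \<or> (\<exists>e\<in>E - E'. g = e \<or> g = - e)"
    and E_D: "e \<in> E \<Longrightarrow> e \<in> D" "e \<in> E \<Longrightarrow> - e \<in> D"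
    and c_pos: "c n > 0"
    and c_lim: "c \<longlonglongrightarrow> 0"
    and c_sum: "filterlim (\<lambda>n. \<Sum>k<n. c k) at_top sequentially"
    and \<phi>: "\<phi> m \<in> D"
    and \<phi>_max: "g \<in> D \<Longrightarrow> inner (r m) g \<le> inner (r m) (\<phi> m)"
    and r_Suc: "r (Suc m) = r m - c m *\<^sub>R \<phi> m"
begin

definition \<sigma> :: "nat \<Rightarrow> real" where "\<sigma> m = inner (r m) (\<phi> m)"

lemma abs_inner_le_\<sigma>: "e \<in> E \<Longrightarrow> \<bar>inner (r m) e\<bar> \<le> \<sigma> m"
  using \<phi>_max[of e m] \<phi>_max[of "- e" m] E_D[of e] by (auto simp: \<sigma>_def)

lemma \<phi>_cases:
  obtains (inside) "\<phi> m \<in> span E'"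
  | (outside) e where "e \<in> E - E'" "\<phi> m = e \<or> \<phi> m = - e"
  using D_cases[OF \<phi>[of m]] by blast

lemma norm_r_Suc: "(norm (r (Suc m)))\<^sup>2 = (norm (r m))\<^sup>2 - 2 * c m * \<sigma> m + (c m)\<^sup>2"
  using D_unit[OF \<phi>[of m]] unfolding power2_norm_eq_inner r_Suc \<sigma>_def
  by (simp add: inner_diff_left inner_diff_right inner_commute norm_eq_1 power2_eq_square
      algebra_simps)

lemma inner_span_E': "e \<in> E - E' \<Longrightarrow> g \<in> span E' \<Longrightarrow> inner g e = 0"
  using inner_span_eq_0[of e E' g] E' by auto

text \<open>If \<sigma> stayed at least \<epsilon> while \<open>c n < \<epsilon>\<close>, each step
  would lower the squared norm by at least \<open>\<epsilon> * c n\<close>, and the divergent sum of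
  coefficients would make it negative.\<close>

lemma \<sigma>_small:
  assumes "0 < \<epsilon>" obtains n where "n \<ge> M" "\<sigma> n < \<epsilon>" "\<And>k. k \<ge> n \<Longrightarrow> c k < \<epsilon>"
proof -
  obtain N where N: "c n < \<epsilon>" if "n \<ge> N" for n
    using order_tendstoD(2)[OF c_lim assms] by (auto simp: eventually_sequentially)
  define K where "K = max M N"
  have "\<exists>n\<ge>K. \<sigma> n < \<epsilon>"
  proof (rule ccontr)
    assume "\<not> ?thesis"
    then have ge: "\<epsilon> \<le> \<sigma> n" if "n \<ge> K" for n using that by force
    \<comment> \<open>\<open>B\<close> is the starting value of a quantity that no step from index
      \<open>K\<close> on increases.\<close>
    define B where "B = (norm (r K))\<^sup>2 + \<epsilon> * (\<Sum>k<K. c k)"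
    have *: "(norm (r n))\<^sup>2 + \<epsilon> * (\<Sum>k<n. c k) \<le> B" if "n \<ge> K" for n
      using that
    proof (induction n rule: dec_induct)
      case (step n)
      have "c n * \<epsilon> \<le> c n * \<sigma> n" "c n * c n \<le> c n * \<epsilon>"
        using step ge[of n] N[of n] c_pos[of n] by (auto simp: K_def)
      then show ?case
        using step.IH norm_r_Suc[of n] unfolding power2_eq_square[of "c n"]
        by (simp add: algebra_simps)
    qed (simp add: B_def)
    obtain n where n: "n \<ge> K" "(\<Sum>k<n. c k) \<ge> B / \<epsilon> + 1"
      using c_sum unfolding filterlim_at_top eventually_sequentially by (meson nat_le_linear)
    have "\<epsilon> * (B / \<epsilon> + 1) \<le> \<epsilon> * (\<Sum>k<n. c k)" using n assms by (intro mult_left_mono) auto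
    moreover have "\<epsilon> * (B / \<epsilon> + 1) = B + \<epsilon>" using assms by (simp add: field_simps)
    moreover have "(norm (r n))\<^sup>2 \<ge> 0" by simp
    ultimately show False using *[OF n(1)] assms by linarith
  qed
  then show thesis using that N by (force simp: K_def)
qed

section \<open>Component in the span of \<open>E'\<close> and decay of \<sigma>\<close>

abbreviation u :: "nat \<Rightarrow> 'a" where "u m \<equiv> orthonormal_proj E' (r m)"

lemma norm_u_le: "norm (u m) \<le> card E' * \<sigma> m"
proof -
  have "norm (u m) \<le> (\<Sum>e\<in>E'. norm (inner (r m) e *\<^sub>R e))"
    unfolding orthonormal_proj_def by (rule norm_sum)
  also have "\<dots> \<le> (\<Sum>e\<in>E'. \<sigma> m)"
    using E' unit abs_inner_le_\<sigma> by (intro sum_mono) (auto simp: subset_eq)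
  finally show ?thesis by simp
qed

lemma u_Suc_outside:
  assumes "e \<in> E - E'" "\<phi> m = e \<or> \<phi> m = - e" shows "u (Suc m) = u m"
  unfolding orthonormal_proj_def
proof (rule sum.cong)
  fix d assume "d \<in> E'"
  then have "inner (\<phi> m) d = 0"
    using inner_span_E'[OF assms(1), of d] assms(2) by (auto simp: span_base inner_commute)
  then show "inner (r (Suc m)) d *\<^sub>R d = inner (r m) d *\<^sub>R d"
    by (simp add: r_Suc inner_diff_left)
qed simp

text \<open>If \<open>c m \<le> 2 * \<sigma> m\<close>, the step does not lengthen
  \<open>u m\<close>. Otherwise \<open>\<sigma> m < c m\<close>, so \<open>norm_u_le\<close> bounds
  \<open>u m\<close> by \<open>card E' * c m\<close>, and the step adds at most
  \<open>c m\<close>.\<close>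

lemma norm_u_Suc_inside:
  assumes "\<phi> m \<in> span E'"
  shows "norm (u (Suc m)) \<le> max (norm (u m)) ((card E' + 1) * c m)"
proof -
  have eq: "u (Suc m) = u m - c m *\<^sub>R \<phi> m"
    unfolding r_Suc orthonormal_proj_diff[OF E']
    using orthonormal_proj_span[OF E', of "c m *\<^sub>R \<phi> m"] assms by (simp add: span_scale)
  have inner: "inner (u m) (\<phi> m) = \<sigma> m"
    using assms inner_orthonormal_proj_span[OF E'] by (simp add: \<sigma>_def)
  show ?thesis
  proof (cases "c m \<le> 2 * \<sigma> m")
    case True
    have "(norm (u (Suc m)))\<^sup>2 = (norm (u m))\<^sup>2 - c m * (2 * \<sigma> m - c m)"
      using D_unit[OF \<phi>[of m]] inner unfolding eq power2_norm_eq_inner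
      by (simp add: inner_diff_left inner_diff_right inner_commute norm_eq_1 power2_eq_square
          algebra_simps)
    also have "\<dots> \<le> (norm (u m))\<^sup>2" using True c_pos[of m] by simp
    finally have "norm (u (Suc m)) \<le> norm (u m)" by (rule power2_le_imp_le) simp
    then show ?thesis by simp
  next
    case False
    have "norm (u (Suc m)) \<le> norm (u m) + c m"
      using norm_triangle_ineq4[of "u m" "c m *\<^sub>R \<phi> m"] D_unit[OF \<phi>[of m]] c_pos[of m]
      by (simp add: eq)
    also have "norm (u m) \<le> card E' * c m"
      using norm_u_le[of m] False c_pos[of m]
      by (intro order_trans[OF norm_u_le] mult_left_mono) auto
    finally show ?thesis by (simp add: algebra_simps)
  qed
qed

lemma inner_Suc_outside:
  assumes "e \<in> E - E'" "\<phi> m \<noteq> e" "\<phi> m \<noteq> - e"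
  shows "inner (r (Suc m)) e = inner (r m) e"
proof -
  have "inner (\<phi> m) e = 0"
    using D_cases[OF \<phi>[of m]] assms inner_span_E'[of e "\<phi> m"] inner_basis[of _ e] by auto
  then show ?thesis by (simp add: r_Suc inner_diff_left)
qed

text \<open>Maximality makes the sign of \<open>\<phi> m\<close> match the coordinate, whose modulus
  becomes \<open>\<bar>\<sigma> m - c m\<bar>\<close>.\<close>

lemma abs_inner_Suc_chosen:
  assumes "e \<in> E" "\<phi> m = e \<or> \<phi> m = - e"
  shows "\<bar>inner (r m) e\<bar> = \<sigma> m" "\<bar>inner (r (Suc m)) e\<bar> \<le> max (\<sigma> m) (c m)"
proof -
  have "\<bar>inner (r m) e\<bar> \<le> \<sigma> m" by (rule abs_inner_le_\<sigma>[OF assms(1)])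
  moreover have "(\<sigma> m = inner (r m) e \<and> inner (r (Suc m)) e = inner (r m) e - c m) \<or>
      (\<sigma> m = - inner (r m) e \<and> inner (r (Suc m)) e = inner (r m) e + c m)"
    using assms(2) inner_basis[OF assms(1) assms(1)] unfolding \<sigma>_def r_Suc
    by (elim disjE) (simp_all add: inner_diff_left inner_add_left)
  ultimately show "\<bar>inner (r m) e\<bar> = \<sigma> m" "\<bar>inner (r (Suc m)) e\<bar> \<le> max (\<sigma> m) (c m)"
    using c_pos[of m] by linarith+
qed

lemma \<sigma>_tendsto_0: "\<sigma> \<longlonglongrightarrow> 0"
proof (rule LIMSEQ_I)
  fix \<delta> :: real assume "0 < \<delta>"
  \<comment> \<open>The factor \<open>K\<close> covers both the bound
    \<open>card E' * \<epsilon>\<close> at the start and the factor \<open>card E' + 1\<close> of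
    \<open>norm_u_Suc_inside\<close>; the choice of \<epsilon> gives
    \<open>K * \<epsilon> = \<delta> / 2\<close>.\<close>
  define K where "K = real (card E') + 1"
  define \<epsilon> where "\<epsilon> = \<delta> / (2 * K)"
  have K: "K \<ge> 1" by (simp add: K_def)
  then have \<epsilon>: "\<epsilon> > 0" "K * \<epsilon> < \<delta>" using \<open>0 < \<delta>\<close> by (auto simp: \<epsilon>_def)
  obtain N where \<sigma>N: "\<sigma> N < \<epsilon>" and cN: "\<And>k. k \<ge> N \<Longrightarrow> c k < \<epsilon>"
    using \<sigma>_small[OF \<epsilon>(1), of 0] by blast
  \<comment> \<open>The induction carries this pair of bounds rather than
    \<open>\<sigma> n < \<epsilon>\<close>; together they control \<sigma> up to the factor
    \<open>K\<close>.\<close>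
  have inv: "norm (u n) \<le> K * \<epsilon> \<and> (\<forall>e\<in>E - E'. \<bar>inner (r n) e\<bar> \<le> \<epsilon>)" if "n \<ge> N" for n
    using that
  proof (induction n rule: dec_induct)
    case base
    have "norm (u N) \<le> card E' * \<epsilon>"
      using \<sigma>N by (intro order_trans[OF norm_u_le] mult_left_mono) auto
    moreover have "\<bar>inner (r N) e\<bar> \<le> \<epsilon>" if "e \<in> E - E'" for e
      using abs_inner_le_\<sigma>[of e N] \<sigma>N that by auto
    ultimately show ?case using \<epsilon> by (auto simp: K_def algebra_simps)
  next
    case (step n)
    have cn: "c n < \<epsilon>" using cN step by simp
    show ?case
    proof (cases n rule: \<phi>_cases)
      case in_span: inside
      have "K * c n \<le> K * \<epsilon>" using cn K by simp
      then have "norm (u (Suc n)) \<le> K * \<epsilon>"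
        using norm_u_Suc_inside[OF in_span] step.IH
        unfolding K_def of_nat_add of_nat_1 by linarith
      moreover have "inner (r (Suc n)) e = inner (r n) e" if "e \<in> E - E'" for e
        using inner_span_E'[OF that in_span] by (simp add: r_Suc inner_diff_left)
      ultimately show ?thesis using step.IH by auto
    next
      case (outside e)
      have "\<bar>inner (r (Suc n)) d\<bar> \<le> \<epsilon>" if d: "d \<in> E - E'" for d
      proof (cases "\<phi> n = d \<or> \<phi> n = - d")
        case True
        then show ?thesis using abs_inner_Suc_chosen[of d n] d step.IH cn by force
      next
        case False
        then show ?thesis using inner_Suc_outside[OF d] step.IH d by auto
      qed
      then show ?thesis using u_Suc_outside[OF outside] step.IH by simp
    qed
  qed
  have "norm (\<sigma> n - 0) < \<delta>" if "n \<ge> N" for n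
  proof -
    have "\<bar>\<sigma> n\<bar> \<le> K * \<epsilon>"
    proof (cases n rule: \<phi>_cases)
      case inside
      \<comment> \<open>A choice inside \<open>span E'\<close> sees only \<open>u n\<close>, whose
        norm therefore bounds \<sigma>.\<close>
      then have "\<sigma> n = inner (u n) (\<phi> n)"
        using inner_orthonormal_proj_span[OF E'] by (simp add: \<sigma>_def)
      then have "\<bar>\<sigma> n\<bar> \<le> norm (u n)"
        using Cauchy_Schwarz_ineq2[of "u n" "\<phi> n"] D_unit[OF \<phi>[of n]] by simp
      then show ?thesis using inv[OF that] by linarith
    next
      case (outside e)
      then have "\<bar>\<sigma> n\<bar> \<le> \<epsilon>" using inv[OF that] by (auto simp: \<sigma>_def)
      also have "\<epsilon> \<le> K * \<epsilon>" using K \<epsilon> by simp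
      finally show ?thesis .
    qed
    then show ?thesis using \<epsilon>(2) by simp
  qed
  then show "\<exists>N. \<forall>n\<ge>N. norm (\<sigma> n - 0) < \<delta>" by blast
qed

section \<open>Coordinates outside \<open>E'\<close> against their initial values\<close>

text \<open>The comparison is with the initial coordinates because they give a square-summable bound
  independent of \<open>m\<close>.\<close>

abbreviation dominated :: "nat \<Rightarrow> 'a \<Rightarrow> bool" where
  "dominated m e \<equiv> \<bar>inner (r m) e\<bar> \<le> \<bar>inner (r 0) e\<bar>"

text \<open>The second alternative describes a coordinate \<open>e\<close> that has left its initial range: as the
  inner products with the other dictionary elements stay below \<open>\<bar>inner (r 0) e\<bar>\<close>, only \<open>\<plusminus>e\<close> can be
  chosen until \<open>e\<close> is dominated again.\<close>

lemma dominated_but_one: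
  "(\<forall>e\<in>E - E'. dominated m e) \<or>
   (\<exists>e\<in>E - E'. \<not> dominated m e \<and> (\<forall>d\<in>E - E' - {e}. dominated m d) \<and>
      (\<forall>g\<in>D - {e, - e}. inner (r m) g \<le> \<bar>inner (r 0) e\<bar>))"
proof (induction m)
  case 0
  then show ?case by simp
next
  case (Suc m)
  \<comment> \<open>It is left open whether \<open>e\<close> is dominated at \<open>m\<close>, so
    this serves both the step at which \<open>e\<close> may escape and the later ones at which it
    returns.\<close>
  have chosen: ?case
    if e: "e \<in> E - E'" and \<phi>e: "\<phi> m = e \<or> \<phi> m = - e"
      and dom: "\<forall>d\<in>E - E' - {e}. dominated m d"
      and le: "\<forall>g\<in>D - {e, - e}. inner (r m) g \<le> \<bar>inner (r 0) e\<bar>" for e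
  proof -
    have same: "inner (r (Suc m)) g = inner (r m) g" if g: "g \<in> D - {e, - e}" for g
    proof -
      have "inner g e = 0"
        using D_cases[of g] g e inner_span_E'[of e g] inner_basis[of _ e] by auto
      then have "inner (\<phi> m) g = 0" using \<phi>e by (auto simp: inner_commute)
      then show ?thesis by (simp add: r_Suc inner_diff_left)
    qed
    have dom': "dominated (Suc m) d" if d: "d \<in> E - E' - {e}" for d
    proof -
      \<comment> \<open>\<open>E\<close> cannot contain both \<open>e\<close> and
        \<open>- e\<close>, hence \<open>same\<close> applies to \<open>d\<close>.\<close>
      have "d \<noteq> - e" using d e inner_basis[of d e] inner_basis[of e e] by auto
      then show ?thesis using same[of d] d dom E_D[of d] by auto
    qed
    have le': "\<forall>g\<in>D - {e, - e}. inner (r (Suc m)) g \<le> \<bar>inner (r 0) e\<bar>"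
      using same le by simp
    show ?thesis
    proof (cases "dominated (Suc m) e")
      case True
      then show ?thesis using dom' by blast
    next
      case False
      then show ?thesis using dom' le' e by blast
    qed
  qed
  from Suc.IH show ?case
  proof (elim disjE bexE conjE)
    assume dom: "\<forall>e\<in>E - E'. dominated m e"
    show ?case
    proof (cases m rule: \<phi>_cases)
      case inside
      then have "inner (r (Suc m)) e = inner (r m) e" if "e \<in> E - E'" for e
        using inner_span_E'[OF that] by (simp add: r_Suc inner_diff_left)
      then show ?thesis using dom by auto
    next
      case (outside e)
      \<comment> \<open>Maximality of the chosen coordinate, still dominated at this time, bounds
        every other inner product too.\<close>
      have "inner (r m) g \<le> \<bar>inner (r 0) e\<bar>" if "g \<in> D" for g
      proof -
        have "inner (r m) g \<le> \<sigma> m" using \<phi>_max[OF that] by (simp add: \<sigma>_def)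
        also have "\<dots> = \<bar>inner (r m) e\<bar>" using abs_inner_Suc_chosen(1)[of e m] outside by simp
        finally show ?thesis using dom outside(1) by force
      qed
      then show ?thesis using outside dom by (intro chosen[of e]) auto
    qed
  next
    fix e assume e: "e \<in> E - E'" and not: "\<not> dominated m e"
      and dom: "\<forall>d\<in>E - E' - {e}. dominated m d"
      and le: "\<forall>g\<in>D - {e, - e}. inner (r m) g \<le> \<bar>inner (r 0) e\<bar>"
    \<comment> \<open>Any other choice would give \<open>\<sigma> m \<le> \<bar>inner (r 0) e\<bar>
      < \<bar>inner (r m) e\<bar> \<le> \<sigma> m\<close>.\<close>
    have "\<phi> m = e \<or> \<phi> m = - e"
    proof (rule ccontr)
      assume "\<not> ?thesis"
      then have "\<sigma> m \<le> \<bar>inner (r 0) e\<bar>" using le \<phi>[of m] by (simp add: \<sigma>_def)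
      then show False using abs_inner_le_\<sigma>[of e m] e not by simp
    qed
    then show ?thesis using e dom le by (intro chosen[of e])
  qed
qed

text \<open>At most one coordinate fails to be dominated, and its square is at most
  \<open>(\<sigma> m)\<^sup>2\<close>.\<close>

lemma sum_outside_le:
  assumes "T \<subseteq> E - E'" "finite T"
  shows "(\<Sum>e\<in>T. (inner (r m) e)\<^sup>2) \<le> (\<Sum>e\<in>T. (inner (r 0) e)\<^sup>2) + (\<sigma> m)\<^sup>2"
proof -
  \<comment> \<open>When every coordinate is dominated, any \<open>d\<close> serves.\<close>
  obtain d where d: "dominated m e" if "e \<in> E - E' - {d}" for e
    using dominated_but_one[of m] by (metis DiffE)
  have "(\<Sum>e\<in>T. (inner (r m) e)\<^sup>2) \<le>
      (\<Sum>e\<in>T. (inner (r 0) e)\<^sup>2 + (if e = d then (\<sigma> m)\<^sup>2 else 0))"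
  proof (intro sum_mono)
    fix e assume e: "e \<in> T"
    have "(inner (r m) e)\<^sup>2 \<le> (\<sigma> m)\<^sup>2"
      using abs_inner_le_\<sigma>[of e m] e assms by (intro abs_le_square_iff[THEN iffD1]) force
    moreover have "(inner (r m) e)\<^sup>2 \<le> (inner (r 0) e)\<^sup>2" if "e \<noteq> d"
      using d[of e] that e assms by (auto simp: abs_le_square_iff)
    ultimately show "(inner (r m) e)\<^sup>2 \<le> (inner (r 0) e)\<^sup>2 + (if e = d then (\<sigma> m)\<^sup>2 else 0)"
      by (auto simp: add_increasing)
  qed
  also have "\<dots> \<le> (\<Sum>e\<in>T. (inner (r 0) e)\<^sup>2) + (\<sigma> m)\<^sup>2"
    using assms by (simp add: sum.distrib)
  finally show ?thesis .
qed

section \<open>Uniform tail estimate and convergence of the remainder\<close>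

text \<open>Finitely many steps use finitely many dictionary elements, each in a finite span. This
  lets \<open>norm_r_le\<close> compare \<open>r m\<close> with \<open>r 0\<close> through finite
  sums.\<close>

lemma r_diff_finite_span:
  obtains T where "T \<subseteq> E" "finite T" "r m - r 0 \<in> span T"
proof -
  have "\<exists>T\<subseteq>E. finite T \<and> r m - r 0 \<in> span T"
  proof (induction m)
    case 0
    then show ?case by (intro exI[of _ "{}"]) auto
  next
    case (Suc m)
    then obtain T where T: "T \<subseteq> E" "finite T" "r m - r 0 \<in> span T" by blast
    obtain e where e: "\<phi> m \<in> span (insert e E')" "insert e E' \<subseteq> E"
    proof (cases "\<phi> m \<in> span E'")
      case True
      \<comment> \<open>Here \<open>e\<close> is only a filler; one exists since a unit vector in
        \<open>span E'\<close> forces \<open>E'\<close> to be nonempty.\<close>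
      obtain e where "e \<in> E"
        using D_cases[OF \<phi>[of m]] True D_unit[OF \<phi>[of m]] E' by (cases "E' = {}") auto
      then show thesis using that True E' span_mono[of E' "insert e E'"] by blast
    next
      case False
      then show thesis
        using that D_cases[OF \<phi>[of m]] E' span_base[of _ "insert _ E'"] span_neg
        by (metis DiffD1 insertI1 insert_subset)
    qed
    have "r (Suc m) - r 0 = (r m - r 0) - c m *\<^sub>R \<phi> m" by (simp add: r_Suc)
    also have "\<dots> \<in> span (T \<union> insert e E')"
      using T(3) e(1)
      by (intro span_diff[OF _ span_scale] span_mono[THEN subsetD, of T "T \<union> insert e E'"]
          span_mono[THEN subsetD, of "insert e E'" "T \<union> insert e E'"]) auto
    finally show ?case using T e E' by (intro exI[of _ "T \<union> insert e E'"]) auto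
  qed
  then show thesis using that by blast
qed

text \<open>The point is that \<open>K\<close> does not depend on \<open>m\<close>. Coordinates in a
  fixed finite \<open>S\<close> have modulus at most \<open>\<sigma> m\<close>; the squares of the
  others sum to at most a tail of \<open>r 0\<close> plus \<open>(\<sigma> m)\<^sup>2\<close>; what
  remains is a residual of \<open>r 0\<close>.\<close>

lemma norm_r_le:
  assumes "0 < \<epsilon>"
  obtains K where "\<And>m. (norm (r m))\<^sup>2 \<le> K * (\<sigma> m)\<^sup>2 + 2 * \<epsilon>\<^sup>2"
proof -
  obtain S0 y where S0: "S0 \<subseteq> E" "finite S0" "y \<in> span S0" "norm (r 0 - y) < \<epsilon>"
    using finite_span_approx[OF dense assms] by blast
  \<comment> \<open>Adding \<open>E'\<close> puts every set \<open>T - S\<close> outside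
    \<open>E'\<close>, as \<open>sum_outside_le\<close> demands.\<close>
  define S where "S = S0 \<union> E'"
  have S: "S \<subseteq> E" "finite S" "y \<in> span S" using S0 E' span_mono[of S0 S] by (auto simp: S_def)
  have "(norm (r m))\<^sup>2 \<le> (card S + 1) * (\<sigma> m)\<^sup>2 + 2 * \<epsilon>\<^sup>2" for m
  proof -
    obtain T0 where T0: "T0 \<subseteq> E" "finite T0" "r m - r 0 \<in> span T0"
      using r_diff_finite_span by blast
    define T where "T = T0 \<union> S"
    have T: "T \<subseteq> E" "finite T" "r m - r 0 \<in> span T" "y \<in> span T"
      using T0 S span_mono[of T0 T] span_mono[of S T] by (auto simp: T_def)
    \<comment> \<open>As \<open>y\<close> lies in \<open>span S\<close>, subtracting it leaves the
      coordinates on \<open>T - S\<close> unchanged; Pythagoras for \<open>r 0 - y\<close> then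
      gives both terms.\<close>
    have "(norm (r 0 - orthonormal_proj T (r 0)))\<^sup>2 + (\<Sum>e\<in>T - S. (inner (r 0) e)\<^sup>2)
        \<le> (norm (r 0 - y))\<^sup>2"
    proof -
      have "(norm (orthonormal_proj T (r 0 - y)))\<^sup>2 = (\<Sum>e\<in>T. (inner (r 0 - y) e)\<^sup>2)"
        using norm_orthonormal_proj T by blast
      also have "\<dots> \<ge> (\<Sum>e\<in>T - S. (inner (r 0 - y) e)\<^sup>2)"
        using T by (intro sum_mono2) auto
      also have "(\<Sum>e\<in>T - S. (inner (r 0 - y) e)\<^sup>2) = (\<Sum>e\<in>T - S. (inner (r 0) e)\<^sup>2)"
        using S T inner_span_eq_0[of _ S y]
        by (intro sum.cong) (auto simp: inner_diff_left subset_eq)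
      finally show ?thesis
        using norm_diff_span[OF T(1,2,4), of "r 0"] T
          orthonormal_proj_diff[OF T(1,2), of "r 0" y] orthonormal_proj_span[OF T(1,2,4)] by simp
    qed
    also have "\<dots> \<le> \<epsilon>\<^sup>2" using S0(4) by (intro power_mono) auto
    finally have tail: "(norm (r 0 - orthonormal_proj T (r 0)))\<^sup>2 +
        (\<Sum>e\<in>T - S. (inner (r 0) e)\<^sup>2) \<le> \<epsilon>\<^sup>2" .
    \<comment> \<open>Since \<open>r m - r 0\<close> lies in \<open>span T\<close>, the residual off
      \<open>T\<close> is the same at times \<open>m\<close> and 0.\<close>
    have "orthonormal_proj T (r m) - orthonormal_proj T (r 0) = r m - r 0"
      using orthonormal_proj_diff[OF T(1,2), of "r m" "r 0"] orthonormal_proj_span[OF T(1,2,3)]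
      by simp
    then have res: "r m - orthonormal_proj T (r m) = r 0 - orthonormal_proj T (r 0)"
      by (simp add: algebra_simps)
    have "(\<Sum>e\<in>S. (inner (r m) e)\<^sup>2) \<le> (\<Sum>e\<in>S. (\<sigma> m)\<^sup>2)"
    proof (intro sum_mono)
      fix e assume "e \<in> S"
      then show "(inner (r m) e)\<^sup>2 \<le> (\<sigma> m)\<^sup>2"
        using abs_inner_le_\<sigma>[of e m] S by (intro abs_le_square_iff[THEN iffD1]) force
    qed
    moreover have "(\<Sum>e\<in>T - S. (inner (r m) e)\<^sup>2) \<le> (\<Sum>e\<in>T - S. (inner (r 0) e)\<^sup>2) + (\<sigma> m)\<^sup>2"
      using T by (intro sum_outside_le) (auto simp: S_def)
    moreover have "(\<Sum>e\<in>T. (inner (r m) e)\<^sup>2) =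
        (\<Sum>e\<in>T - S. (inner (r m) e)\<^sup>2) + (\<Sum>e\<in>S. (inner (r m) e)\<^sup>2)"
      using T by (intro sum.subset_diff) (auto simp: T_def)
    ultimately have "(norm (r m))\<^sup>2 \<le> \<epsilon>\<^sup>2 + (card S * (\<sigma> m)\<^sup>2 + (\<sigma> m)\<^sup>2)"
      using norm_sq_orthonormal_proj[OF T(1,2), of "r m"] tail unfolding res by simp
    then show ?thesis using zero_le_power2[of \<epsilon>] unfolding of_nat_add of_nat_1 distrib_right by linarith
  qed
  then show thesis using that by blast
qed

lemma r_tendsto_0: "r \<longlonglongrightarrow> 0"
proof (rule LIMSEQ_I)
  fix \<delta> :: real assume "0 < \<delta>"
  define \<epsilon> where "\<epsilon> = \<delta> / 2"
  have "0 < \<epsilon>" using \<open>0 < \<delta>\<close> by (simp add: \<epsilon>_def)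
  then obtain K where K: "\<And>m. (norm (r m))\<^sup>2 \<le> K * (\<sigma> m)\<^sup>2 + 2 * \<epsilon>\<^sup>2"
    using norm_r_le by blast
  have "(\<lambda>m. K * (\<sigma> m)\<^sup>2 + 2 * \<epsilon>\<^sup>2) \<longlonglongrightarrow> K * 0\<^sup>2 + 2 * \<epsilon>\<^sup>2"
    by (intro tendsto_intros \<sigma>_tendsto_0)
  moreover have "K * 0\<^sup>2 + 2 * \<epsilon>\<^sup>2 < \<delta>\<^sup>2"
    using \<open>0 < \<delta>\<close> by (simp add: \<epsilon>_def power2_eq_square)
  ultimately obtain N where N: "K * (\<sigma> m)\<^sup>2 + 2 * \<epsilon>\<^sup>2 < \<delta>\<^sup>2" if "m \<ge> N" for m
    using order_tendstoD(2)[of _ _ sequentially "\<delta>\<^sup>2"] unfolding eventually_sequentially by metis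
  have "norm (r m - 0) < \<delta>" if "m \<ge> N" for m
    using order_le_less_trans[OF K[of m] N[OF that]] \<open>0 < \<delta>\<close>
    by (simp add: power2_less_imp_less)
  then show "\<exists>N. \<forall>m\<ge>N. norm (r m - 0) < \<delta>" by blast
qed

end

section \<open>Reduction to remainders that never vanish\<close>

theorem corollary4p3:
  fixes E E' Y D :: "'a::{real_inner, complete_space} set"
    and c :: "nat \<Rightarrow> real"
  assumes "orthonormal_basis E"
    and "E' \<subseteq> E" and "finite E'"
    and "Y \<subseteq> span E'" and "\<forall>y\<in>Y. norm y = 1"
    and "D = symmetrized E \<union> symmetrized Y"
    and "\<forall>b :: nat \<Rightarrow> real. (\<forall>n. b n > 0) \<longrightarrow>
           (\<forall>h. \<exists>\<phi> r G. greedy_expansion D b h \<phi> r G)"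
    and "\<forall>n. c n > 0"
    and "c \<longlonglongrightarrow> 0"
    and "filterlim (\<lambda>n. \<Sum>k<n. c k) at_top sequentially"
  shows "\<forall>f \<phi> r G. greedy_expansion D c f \<phi> r G \<longrightarrow> G \<longlonglongrightarrow> f"
proof (intro allI impI)
  fix f \<phi> r G assume greedy: "greedy_expansion D c f \<phi> r G"
  note step = greedy[unfolded greedy_expansion_def]
  have D_unit: "norm g = 1" if "g \<in> D" for g
    using dictionary_symmetrized_Un[OF assms(1,5)] that assms(6) by (simp add: dictionary_def)
  have "r \<longlonglongrightarrow> 0"
  proof (cases "\<exists>m. r m = 0")
    case True
    then obtain m where m: "r m = 0" by blast
    have "r n = 0" if "n \<ge> m" for n
      using that by (induction n rule: dec_induct) (use m step in auto)
    then have "\<forall>\<^sub>F n in sequentially. r n = 0" by (auto simp: eventually_sequentially)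
    then show ?thesis by (rule tendsto_eventually)
  next
    case False
    \<comment> \<open>Boundedness makes the real-valued \<open>SUP\<close> an actual upper bound of
      the inner products.\<close>
    have bdd: "bdd_above (inner (r m) ` D)" for m
    proof (rule bdd_aboveI2)
      fix g assume "g \<in> D"
      then show "inner (r m) g \<le> norm (r m)"
        using norm_cauchy_schwarz[of "r m" g] D_unit by simp
    qed
    interpret nonvanishing_greedy E E' D c \<phi> r
    proof
      fix g assume "g \<in> D"
      then show "g \<in> span E' \<or> (\<exists>e\<in>E - E'. g = e \<or> g = - e)"
        using assms(4,6) by (auto simp: symmetrized_def span_base span_neg)
    next
      fix g m assume "g \<in> D"
      then show "inner (r m) g \<le> inner (r m) (\<phi> m)"
        using step False cSUP_upper[OF _ bdd, of g m] by auto
    qed (use assms step False D_unit in \<open>auto simp: orthonormal_basis_def symmetrized_def\<close>)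
    show ?thesis by (rule r_tendsto_0)
  qed
  then have "(\<lambda>m. f - r m) \<longlonglongrightarrow> f - 0" by (intro tendsto_intros)
  moreover have "f - r m = G m" for m
    using greedy_expansion_partial_sum[OF greedy, of m] by (simp add: algebra_simps)
  ultimately show "G \<longlonglongrightarrow> f" by simp
qed

end
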